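(* Let $\mathcal{X}\subseteq\mathbb{R}^d$, let $f:\mathcal{X}\to\mathbb{R}$ be twice continuously differentiable and $\mu$-strongly convex ($\mu>0$) with minimizer $x^*$, let $\gamma>\frac1{2\mu}$, and let $x_N$ ($N\ge1$) be the random $\mathcal{X}$-valued stochastic gradient descent iterates, with $\Sigma_\infty$ as in the context. Let $\epsilon_t>0$ and $\alpha_t\in(0,1)$. Suppose that for every positive integer $N$, $$N\big(f(x_N)-f(x^* )\big)\sim Z^\top\nabla^2f(x^* )Z,\qquad Z\sim\mathcal{N}(0,\Sigma_\infty)$$ (equality in distribution). Put $$b=\frac{\gamma^2}{2\gamma\mu-1}\,\|\operatorname{Cov}(G(x^*,\xi))\|_2\,\|\nabla^2f(x^* )\|_2$$ and let $$N^t=\min\Big\{N\in\mathbb{Z}_{\ge1}:\ N\ge\frac{b}{\epsilon_t}\max\Big\{4\log\frac1{\alpha_t}+\frac{3d}{2},\ 2d\Big\}\Big\}.$$ Then $$\mathbb{P}\big(f(x_{N^t})-f(x^* )>\epsilon_t\big)\le\alpha_t.$$ Furthermore, $N^t$, as a function of $\gamma\in(\frac{1}{2\mu},\infty)$, is minimized at $\gamma^*=\frac1\mu$, for which the value of $b$ is $b^*=\frac1{\mu^2}\|\operatorname{Cov}(G(x^*,\xi))\|_2\|\nabla^2f(x^* )\|_2$.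
   Context: $\mathcal{X}\subseteq\mathbb{R}^d$ is closed and convex; $\mu$-strong convexity means $f(y)-f(x)-\langle\nabla f(x),y-x\rangle\ge\frac{\mu}{2}\|x-y\|_2^2$ for all $x,y\in\mathcal{X}$, so that $\nabla^2f(x^* )\succeq\mu I$. $G(x,\xi)$ is a stochastic gradient of $f$ with covariance matrix $\operatorname{Cov}(G(x,\xi))$, and $x_N$ is the $N$-th iterate of stochastic gradient descent with step sizes $\gamma/\ell$. The $d\times d$ matrix $\Sigma_\infty$ is defined by $$\operatorname{vec}(\Sigma_\infty)=\gamma^2\Big(\big(\gamma\nabla^2f(x^* )-\tfrac{I}{2}\big)\oplus\big(\gamma\nabla^2f(x^* )-\tfrac{I}{2}\big)\Big)^{-1}\operatorname{vec}\big(\operatorname{Cov}(G(x^*,\xi))\big),$$ where $\operatorname{vec}$ is column stacking and $A\oplus B=A\otimes I+I\otimes B$ is the Kronecker sum; equivalently $\Sigma_\infty=\gamma^2\int_0^\infty e^{(-\gamma\nabla^2f(x^* )+I/2)s}\operatorname{Cov}(G(x^*,\xi))e^{(-\gamma\nabla^2f(x^* )+I/2)s}\,ds$. $\|\cdot\|_2$ of a matrix is the spectral norm. *)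

theory Defs
  imports "HOL-Probability.Probability"
begin

section \<open>Smooth strongly convex functions on a closed convex set\<close>

text \<open>
  \<open>f\<close> is only meant to be given on \<open>X\<close>, so its gradient \<open>g\<close> and Hessian \<open>H\<close> are derivatives
  relative to \<open>X\<close>. They are unique when the convex set \<open>X\<close> has nonempty interior.
\<close>

definition C2_on ::
  "(real ^ 'd::finite) set \<Rightarrow> (real ^ 'd \<Rightarrow> real) \<Rightarrow> (real ^ 'd \<Rightarrow> real ^ 'd)
     \<Rightarrow> (real ^ 'd \<Rightarrow> real ^ 'd ^ 'd) \<Rightarrow> bool" where
  "C2_on X f g H \<longleftrightarrow>
     (\<forall>x\<in>X. (f has_derivative (\<lambda>h. g x \<bullet> h)) (at x within X)) \<and>
     (\<forall>x\<in>X. (g has_derivative (\<lambda>h. H x *v h)) (at x within X)) \<and>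
     continuous_on X H"

definition strongly_convex_on ::
  "(real ^ 'd::finite) set \<Rightarrow> (real ^ 'd \<Rightarrow> real) \<Rightarrow> (real ^ 'd \<Rightarrow> real ^ 'd) \<Rightarrow> real \<Rightarrow> bool" where
  "strongly_convex_on X f g \<mu> \<longleftrightarrow>
     (\<forall>x\<in>X. \<forall>y\<in>X. f y - f x - g x \<bullet> (y - x) \<ge> \<mu> / 2 * (norm (x - y))\<^sup>2)"

definition loewner_le :: "real ^ 'd ^ 'd \<Rightarrow> real ^ 'd::finite ^ 'd \<Rightarrow> bool" where
  "loewner_le A B \<longleftrightarrow> transpose (B - A) = B - A \<and> (\<forall>v. 0 \<le> v \<bullet> ((B - A) *v v))"


section \<open>Stochastic gradient descent\<close>

definition cov_mat :: "'s measure \<Rightarrow> ('s \<Rightarrow> real ^ 'd::finite) \<Rightarrow> real ^ 'd ^ 'd" where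
  "cov_mat D Y = (\<chi> i j. \<integral>s. (Y s $ i - (\<integral>u. Y u \<partial>D) $ i) * (Y s $ j - (\<integral>u. Y u \<partial>D) $ j) \<partial>D)"

text \<open>
  \<open>D\<close> is the law of \<open>\<xi>\<close>: an unbiased estimator of the gradient with finite second moments,
  so that \<open>cov_mat D (G x)\<close> is the covariance matrix of \<open>G(x, \<xi>)\<close>.
\<close>

definition stochastic_gradient ::
  "'s measure \<Rightarrow> (real ^ 'd::finite) set \<Rightarrow> (real ^ 'd \<Rightarrow> real ^ 'd)
     \<Rightarrow> (real ^ 'd \<Rightarrow> 's \<Rightarrow> real ^ 'd) \<Rightarrow> bool" where
  "stochastic_gradient D X g G \<longleftrightarrow>
     prob_space D \<and>
     (\<lambda>(x, s). G x s) \<in> borel_measurable (restrict_space borel X \<Otimes>\<^sub>M D) \<and>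
     (\<forall>x\<in>X. integrable D (\<lambda>s. (norm (G x s))\<^sup>2) \<and> (\<integral>s. G x s \<partial>D) = g x)"

text \<open>
  The initial point \<open>x 0\<close> may be random. The \<open>l\<close>-th step has size \<open>\<gamma> / l\<close>, uses the fresh
  sample \<open>\<xi> l\<close> and produces \<open>x l\<close>, for \<open>l \<ge> 1\<close>. The metric projection \<open>closest_point X\<close> is
  the identity on \<open>X\<close>, so unprojected descent staying inside \<open>X\<close> is a special case.
\<close>

definition sgd_iterates ::
  "'w measure \<Rightarrow> 's measure \<Rightarrow> (real ^ 'd::finite) set \<Rightarrow> (real ^ 'd \<Rightarrow> 's \<Rightarrow> real ^ 'd)
     \<Rightarrow> real \<Rightarrow> (nat \<Rightarrow> 'w \<Rightarrow> 's) \<Rightarrow> (nat \<Rightarrow> 'w \<Rightarrow> real ^ 'd) \<Rightarrow> bool" where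
  "sgd_iterates M D X G \<gamma> \<xi> x \<longleftrightarrow>
     prob_space M \<and>
     x 0 \<in> borel_measurable M \<and> (\<forall>\<omega>\<in>space M. x 0 \<omega> \<in> X) \<and>
     (\<forall>l\<ge>1. \<xi> l \<in> measurable M D \<and> distr M D (\<xi> l) = D) \<and>
     prob_space.indep_sets M
       (\<lambda>l. if l = 0 then sets (vimage_algebra (space M) (x 0) borel)
            else sets (vimage_algebra (space M) (\<xi> l) D)) UNIV \<and>
     (\<forall>l\<ge>1. \<forall>\<omega>\<in>space M.
        x l \<omega> = closest_point X (x (l - 1) \<omega> - (\<gamma> / real l) *\<^sub>R G (x (l - 1) \<omega>) (\<xi> l \<omega>)))"


section \<open>Column stacking and Kronecker sums\<close>

text \<open>
  Coordinates of a vector of length \<open>d\<^sup>2\<close> are indexed by pairs, read in lexicographic order;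
  column stacking thus puts the entry in row \<open>i\<close> and column \<open>j\<close> at position \<open>(j, i)\<close>.
\<close>

definition vec_stack :: "real ^ 'd::finite ^ 'd \<Rightarrow> real ^ ('d \<times> 'd)" where
  "vec_stack A = (\<chi> p. A $ snd p $ fst p)"

definition kronecker ::
  "real ^ 'd ^ 'd \<Rightarrow> real ^ 'd ^ 'd \<Rightarrow> real ^ ('d::finite \<times> 'd) ^ ('d \<times> 'd)" where
  "kronecker A B = (\<chi> p q. A $ fst p $ fst q * B $ snd p $ snd q)"

definition kronecker_sum ::
  "real ^ 'd ^ 'd \<Rightarrow> real ^ 'd ^ 'd \<Rightarrow> real ^ ('d::finite \<times> 'd) ^ ('d \<times> 'd)" where
  "kronecker_sum A B = kronecker A (mat 1) + kronecker (mat 1) B"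

definition is_Sigma_inf ::
  "real \<Rightarrow> real ^ 'd ^ 'd \<Rightarrow> real ^ 'd ^ 'd \<Rightarrow> real ^ 'd::finite ^ 'd \<Rightarrow> bool" where
  "is_Sigma_inf \<gamma> Hs C \<Sigma> \<longleftrightarrow>
     vec_stack \<Sigma> = \<gamma>\<^sup>2 *\<^sub>R
       (matrix_inv (kronecker_sum (\<gamma> *\<^sub>R Hs - (1 / 2) *\<^sub>R mat 1) (\<gamma> *\<^sub>R Hs - (1 / 2) *\<^sub>R mat 1))
          *v vec_stack C)"


section \<open>Multivariate normal vectors\<close>

definition std_normal_vec :: "(real ^ 'd::finite) measure" where
  "std_normal_vec =
     distr (\<Pi>\<^sub>M i\<in>(UNIV :: 'd set). density lborel (\<lambda>t. ennreal (std_normal_density t)))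
       borel (\<lambda>w. \<chi> i. w i)"

text \<open>
  \<open>Z\<close> is \<open>N(m, \<Sigma>)\<close> if it has the law of \<open>m + A W\<close> with \<open>W\<close> standard normal and \<open>\<Sigma> = A A\<^sup>T\<close>;
  this also covers singular \<open>\<Sigma>\<close>, and the law does not depend on the choice of \<open>A\<close>.
\<close>

definition normal_vector ::
  "'z measure \<Rightarrow> ('z \<Rightarrow> real ^ 'd) \<Rightarrow> real ^ 'd \<Rightarrow> real ^ 'd::finite ^ 'd \<Rightarrow> bool" where
  "normal_vector P Z m \<Sigma> \<longleftrightarrow>
     prob_space P \<and> Z \<in> borel_measurable P \<and>
     (\<exists>A :: real ^ 'd ^ 'd. \<Sigma> = A ** transpose A \<and>
        distr P borel Z = distr std_normal_vec borel (\<lambda>w. m + A *v w))"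


section \<open>The sample size\<close>

definition spectral_norm :: "real ^ 'd ^ 'd::finite \<Rightarrow> real" where
  "spectral_norm A = onorm ((*v) A)"

definition b_const :: "real \<Rightarrow> real ^ 'd ^ 'd \<Rightarrow> real ^ 'd::finite ^ 'd \<Rightarrow> real \<Rightarrow> real" where
  "b_const \<mu> C Hs \<gamma> = \<gamma>\<^sup>2 / (2 * \<gamma> * \<mu> - 1) * spectral_norm C * spectral_norm Hs"

definition sample_size :: "nat \<Rightarrow> real \<Rightarrow> real \<Rightarrow> real \<Rightarrow> nat" where
  "sample_size d \<epsilon> \<alpha> b =
     (LEAST N. N \<ge> 1 \<and>
        real N \<ge> b / \<epsilon> * max (4 * ln (1 / \<alpha>) + 3 * real d / 2) (2 * real d))"

end

theory Submission
  imports Defs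
begin

text \<open>
  Write \<open>Z = A W\<close> with \<open>W\<close> standard normal and \<open>\<Sigma> = A A\<^sup>T\<close>. With \<open>B = \<gamma> H - I / 2\<close>, the Kronecker system
  says \<open>B \<Sigma> + \<Sigma> B\<^sup>T = \<gamma>\<^sup>2 C\<close>; testing it on a top eigenvector of \<open>\<Sigma>\<close> and using \<open>v \<bullet> B v \<ge> \<gamma> \<mu> - 1 / 2\<close>
  for unit vectors \<open>v\<close> bounds the spectral norm of \<open>\<Sigma>\<close> by \<open>\<gamma>\<^sup>2 / (2 \<gamma> \<mu> - 1)\<close> times that of \<open>C\<close>. Hence
  the quadratic form of \<open>Z\<close> is at most \<open>b\<close> times the squared norm of \<open>W\<close>, and a Chernoff bound with
  parameter \<open>1 / 4\<close> finishes, since \<open>\<surd>2 \<le> exp (3 / 8)\<close>. The optimal \<open>\<gamma>\<close> comes from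
  \<open>(\<gamma> \<mu> - 1)\<^sup>2 \<ge> 0\<close>.
\<close>

section \<open>Gaussian norms: exponential moment and tail\<close>

text \<open>The integral factorizes over the coordinates. In each of them
  \<open>exp (t\<^sup>2 / 4)\<close> turns the N(0, 1) density into \<open>sqrt 2\<close> times the
  N(0, 2) density, which has mass 1.\<close>

lemma nn_integral_std_normal_exp:
  "(\<integral>\<^sup>+ w. ennreal (exp ((norm w)\<^sup>2 / 4)) \<partial>(std_normal_vec :: (real ^ 'd::finite) measure)) = ennreal (sqrt 2) ^ CARD('d)"
proof -
  let ?N = "density lborel (\<lambda>t. ennreal (std_normal_density t))"
  have ps: "prob_space ?N" by (rule prob_space_normal_density) simp
  interpret product_sigma_finite "\<lambda>_::'d. ?N"
    unfolding product_sigma_finite_def using ps by (simp add: prob_space_imp_sigma_finite)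
  have one: "(\<integral>\<^sup>+ t. ennreal (exp (t\<^sup>2 / 4)) \<partial>?N) = ennreal (sqrt 2)"
  proof -
    have "prob_space (density lborel (\<lambda>t. ennreal (normal_density 0 (sqrt 2) t)))"
      by (rule prob_space_normal_density) simp
    then have total: "(\<integral>\<^sup>+ t. ennreal (normal_density 0 (sqrt 2) t) \<partial>lborel) = 1"
      by (auto dest!: prob_space.emeasure_space_1 simp: emeasure_density)
    have eq: "std_normal_density t * exp (t\<^sup>2 / 4) = sqrt 2 * normal_density 0 (sqrt 2) t" for t
      by (simp add: normal_density_def real_sqrt_mult field_simps flip: exp_add)
    have "(\<integral>\<^sup>+ t. ennreal (exp (t\<^sup>2 / 4)) \<partial>?N)
        = (\<integral>\<^sup>+ t. ennreal (std_normal_density t * exp (t\<^sup>2 / 4)) \<partial>lborel)"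
      by (subst nn_integral_density) (auto simp: ennreal_mult)
    also have "\<dots> = (\<integral>\<^sup>+ t. ennreal (sqrt 2) * ennreal (normal_density 0 (sqrt 2) t) \<partial>lborel)"
      by (simp add: eq ennreal_mult)
    also have "\<dots> = ennreal (sqrt 2)"
      by (subst nn_integral_cmult) (auto simp: total)
    finally show ?thesis .
  qed
  have meas: "(\<lambda>w. \<chi> i. w i) \<in> borel_measurable (\<Pi>\<^sub>M i\<in>(UNIV :: 'd set). ?N)"
    by (rule borel_measurable_euclidean_space[THEN iffD2]) (auto simp: Basis_vec_def inner_axis)
  have "(\<integral>\<^sup>+ w. ennreal (exp ((norm w)\<^sup>2 / 4)) \<partial>(std_normal_vec :: (real ^ 'd) measure))
      = (\<integral>\<^sup>+ w. ennreal (exp ((norm (\<chi> i. w i :: real ^ 'd))\<^sup>2 / 4)) \<partial>(\<Pi>\<^sub>M i\<in>(UNIV :: 'd set). ?N))"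
    unfolding std_normal_vec_def by (rule nn_integral_distr[OF meas]) simp
  also have "\<dots> = (\<integral>\<^sup>+ w. (\<Prod>i\<in>UNIV. ennreal (exp ((w i)\<^sup>2 / 4))) \<partial>(\<Pi>\<^sub>M i\<in>(UNIV :: 'd set). ?N))"
    by (simp add: prod_ennreal norm_vec_def L2_set_def sum_nonneg sum_divide_distrib flip: exp_sum)
  also have "\<dots> = (\<Prod>i\<in>(UNIV::'d set). (\<integral>\<^sup>+ t. ennreal (exp (t\<^sup>2 / 4)) \<partial>?N))"
    by (rule product_nn_integral_prod) auto
  finally show ?thesis by (simp add: one)
qed

text \<open>Markov's inequality for \<open>exp ((norm w)\<^sup>2 / 4)\<close>; \<open>c\<close> is
  the reciprocal of this exponential at the threshold. The summand \<open>3 * d / 2\<close> of the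
  threshold contributes \<open>exp (- (3 * d / 8))\<close>, which absorbs the moment
  \<open>sqrt 2 ^ d\<close>.\<close>

lemma std_normal_norm_tail:
  fixes \<alpha> :: real
  assumes "0 < \<alpha>"
  shows "emeasure (std_normal_vec :: (real ^ 'd::finite) measure)
           {w. (norm w)\<^sup>2 > 4 * ln (1 / \<alpha>) + 3 * real CARD('d) / 2} \<le> ennreal \<alpha>"
proof -
  let ?S = "std_normal_vec :: (real ^ 'd) measure"
  let ?d = "real CARD('d)"
  define c where "c = exp (- (4 * ln (1 / \<alpha>) + 3 * ?d / 2) / 4)"
  have [simp, measurable_cong]: "sets ?S = sets borel" and [simp]: "space ?S = UNIV"
    by (simp_all add: std_normal_vec_def)
  have c: "c = \<alpha> * exp (- (3 * ?d / 8))" "c > 0"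
  proof -
    have "- (4 * ln (1 / \<alpha>) + 3 * ?d / 2) / 4 = ln \<alpha> + - (3 * ?d / 8)"
      using assms by (simp add: ln_div field_simps)
    then show "c = \<alpha> * exp (- (3 * ?d / 8))"
      unfolding c_def using assms by (simp only: exp_add exp_ln)
  qed (simp add: c_def)
  have "1 \<le> ennreal c * ennreal (exp ((norm w)\<^sup>2 / 4))"
    if "(norm w)\<^sup>2 > 4 * ln (1 / \<alpha>) + 3 * ?d / 2" for w :: "real ^ 'd"
  proof -
    have "c * exp ((norm w)\<^sup>2 / 4) \<ge> 1"
      using that by (simp add: c_def field_simps flip: exp_add)
    then show ?thesis using c by (simp flip: ennreal_mult)
  qed
  then have "emeasure ?S {w. (norm w)\<^sup>2 > 4 * ln (1 / \<alpha>) + 3 * ?d / 2}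
      \<le> emeasure ?S ({w \<in> UNIV. 1 \<le> ennreal c * ennreal (exp ((norm w)\<^sup>2 / 4))})"
    by (intro emeasure_mono) auto
  also have "\<dots> \<le> ennreal c * (\<integral>\<^sup>+ w. ennreal (exp ((norm w)\<^sup>2 / 4)) * indicator UNIV w \<partial>?S)"
    using nn_integral_Markov_inequality[of "\<lambda>w. ennreal (exp ((norm w)\<^sup>2 / 4))" UNIV ?S "ennreal c"]
    by simp
  also have "\<dots> = ennreal (c * sqrt 2 ^ CARD('d))"
    using c by (simp add: nn_integral_std_normal_exp ennreal_mult ennreal_power)
  also have "c * sqrt 2 ^ CARD('d) \<le> \<alpha>"
  proof -
    \<comment> \<open>The comparison with \<open>exp (3 / 8)\<close> amounts to
      \<open>ln 2 \<le> 3 / 4\<close>, and 25/36 is below 3/4.\<close>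
    have "sqrt 2 = exp (ln 2 / 2)" by (simp flip: ln_sqrt)
    also have "\<dots> \<le> exp (3 / 8)" using ln2_le_25_over_36 by simp
    finally have "sqrt 2 ^ CARD('d) \<le> exp (3 / 8) ^ CARD('d)" by (intro power_mono) auto
    also have "\<dots> = exp (3 * ?d / 8)" by (simp flip: exp_of_nat_mult)
    finally have "c * sqrt 2 ^ CARD('d) \<le> c * exp (3 * ?d / 8)" using c(2) by simp
    also have "\<dots> = \<alpha>" by (simp add: c exp_minus)
    finally show ?thesis .
  qed
  finally show ?thesis by (simp add: ennreal_leI)
qed

section \<open>Spectral norms and Kronecker sums\<close>

lemma spectral_norm_nonneg: "0 \<le> spectral_norm A"
  unfolding spectral_norm_def by (intro onorm_pos_le matrix_vector_mul_bounded_linear)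

lemma quadratic_form_le_spectral_norm: "v \<bullet> (A *v v) \<le> spectral_norm A * (norm v)\<^sup>2"
proof -
  have "v \<bullet> (A *v v) \<le> norm v * norm (A *v v)" by (rule norm_cauchy_schwarz)
  also have "\<dots> \<le> norm v * (spectral_norm A * norm v)"
    unfolding spectral_norm_def by (intro mult_left_mono onorm matrix_vector_mul_bounded_linear) simp
  finally show ?thesis by (simp add: power2_eq_square algebra_simps)
qed

lemma sum_UNIV_prod:
  "(\<Sum>p\<in>(UNIV :: ('a::finite \<times> 'b::finite) set). h p) = (\<Sum>a\<in>UNIV. \<Sum>b\<in>UNIV. h (a, b))"
  unfolding UNIV_Times_UNIV[symmetric] by (simp add: sum.cartesian_product split_def)

lemma kronecker_mult_vec_left:
  "(kronecker B (mat 1) *v y) $ (j, i) = (B *v (\<chi> l. y $ (l, i))) $ j"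
  by (simp add: kronecker_def matrix_vector_mult_def mat_def sum_UNIV_prod if_distrib if_distribR
      cong: if_cong)

lemma kronecker_mult_vec_right:
  "(kronecker (mat 1) B *v y) $ (j, i) = (B *v (\<chi> k. y $ (j, k))) $ i"
proof -
  \<comment> \<open>With the delta of the identity matrix outside the inner sum, the outer sum
    collapses to \<open>l = j\<close>.\<close>
  have "(kronecker (mat 1) B *v y) $ (j, i)
      = (\<Sum>l\<in>UNIV. if j = l then (\<Sum>k\<in>UNIV. B $ i $ k * y $ (l, k)) else 0)"
    unfolding kronecker_def matrix_vector_mult_def mat_def sum_UNIV_prod
    by (auto intro!: sum.cong simp del: sum.delta sum.delta')
  then show ?thesis by (simp add: matrix_vector_mult_def)
qed

text \<open>The slices \<open>?L i\<close> together carry the full squared norm of \<open>y\<close>,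
  and so do the slices \<open>?R j\<close>. One Kronecker summand applies \<open>B\<close> to each
  \<open>?L i\<close>, the other to each \<open>?R j\<close>; hence the factor 2.\<close>

lemma kronecker_sum_coercive:
  fixes B :: "real ^ 'd::finite ^ 'd"
  assumes "\<And>v. c * (norm v)\<^sup>2 \<le> v \<bullet> (B *v v)"
  shows "2 * c * (norm y)\<^sup>2 \<le> y \<bullet> (kronecker_sum B B *v y)"
proof -
  let ?L = "\<lambda>i. \<chi> l. y $ (l, i)" and ?R = "\<lambda>j. \<chi> k. y $ (j, k)"
  have "(norm y)\<^sup>2 = (\<Sum>j\<in>UNIV. (norm (?R j))\<^sup>2)"
    by (simp add: power2_norm_eq_inner inner_vec_def sum_UNIV_prod)
  moreover have "\<dots> = (\<Sum>i\<in>UNIV. (norm (?L i))\<^sup>2)"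
    unfolding power2_norm_eq_inner inner_vec_def by (simp, rule sum.swap)
  ultimately have "2 * c * (norm y)\<^sup>2
      = (\<Sum>i\<in>UNIV. c * (norm (?L i))\<^sup>2) + (\<Sum>j\<in>UNIV. c * (norm (?R j))\<^sup>2)"
    by (simp flip: sum_distrib_left)
  also have "\<dots> \<le> (\<Sum>i\<in>UNIV. ?L i \<bullet> (B *v ?L i)) + (\<Sum>j\<in>UNIV. ?R j \<bullet> (B *v ?R j))"
    by (intro add_mono sum_mono assms)
  also have "(\<Sum>i\<in>UNIV. ?L i \<bullet> (B *v ?L i)) = y \<bullet> (kronecker B (mat 1) *v y)"
    unfolding inner_vec_def sum_UNIV_prod kronecker_mult_vec_left by (simp, rule sum.swap)
  also have "(\<Sum>j\<in>UNIV. ?R j \<bullet> (B *v ?R j)) = y \<bullet> (kronecker (mat 1) B *v y)"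
    unfolding inner_vec_def sum_UNIV_prod kronecker_mult_vec_right by simp
  finally show ?thesis
    by (simp add: kronecker_sum_def matrix_vector_mult_add_rdistrib inner_add_right)
qed

lemma invertible_if_coercive:
  fixes K :: "real ^ 'n::finite ^ 'n"
  assumes "c > 0" and "\<And>y. c * (norm y)\<^sup>2 \<le> y \<bullet> (K *v y)"
  shows "invertible K"
proof -
  have "y = 0" if "K *v y = 0" for y
  proof -
    have "c * (norm y)\<^sup>2 \<le> 0" using assms(2)[of y] that by simp
    then show ?thesis using assms(1) by (simp add: mult_le_0_iff)
  qed
  then show ?thesis
    using matrix_left_invertible_ker[of K] by (auto simp: invertible_left_inverse)
qed

text \<open>Column stacking puts the column index first. So \<open>A\<close> mixes the columns of
  \<open>S\<close>, which is right multiplication by its transpose, while \<open>B\<close> mixes the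
  rows.\<close>

lemma kronecker_sum_mult_vec_stack:
  "kronecker_sum A B *v vec_stack S = vec_stack (B ** S + S ** transpose A)"
proof -
  have "(kronecker_sum A B *v vec_stack S) $ (j, i) = vec_stack (B ** S + S ** transpose A) $ (j, i)"
    for j i
    unfolding kronecker_sum_def matrix_vector_mult_add_rdistrib vector_add_component
      kronecker_mult_vec_left kronecker_mult_vec_right
    by (simp add: vec_stack_def matrix_vector_mult_def matrix_matrix_mult_def transpose_def
        mult.commute)
  then show ?thesis by (simp add: vec_eq_iff split_paired_all)
qed

lemma vec_stack_scaleR: "vec_stack (c *\<^sub>R A) = c *\<^sub>R vec_stack A"
  by (simp add: vec_stack_def vec_eq_iff)

lemma vec_stack_eq_iff: "vec_stack A = vec_stack B \<longleftrightarrow> A = B"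
  by (auto simp: vec_stack_def vec_eq_iff)

section \<open>The Lyapunov equation and its spectral bound\<close>

text \<open>Applying the Kronecker sum to the defining formula of \<open>\<Sigma>\<close> undoes the
  inverse, and unstacking leaves a matrix equation. The transpose appears because \<open>Hs\<close>
  is an arbitrary matrix here.\<close>

lemma Lyapunov_equation:
  fixes Hs C :: "real ^ 'd::finite ^ 'd" and \<gamma> :: real
  defines "B \<equiv> \<gamma> *\<^sub>R Hs - (1 / 2) *\<^sub>R mat 1"
  assumes "is_Sigma_inf \<gamma> Hs C \<Sigma>"
    and "c > 0" and "\<And>v. c * (norm v)\<^sup>2 \<le> v \<bullet> (B *v v)"
  shows "B ** \<Sigma> + \<Sigma> ** transpose B = \<gamma>\<^sup>2 *\<^sub>R C"
proof -
  let ?K = "kronecker_sum B B"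
  \<comment> \<open>\<open>matrix_inv\<close> is a Hilbert choice, so it is known to be an inverse
    only once \<open>?K\<close> is known to be invertible.\<close>
  have "invertible ?K"
    by (rule invertible_if_coercive[of "2 * c"]) (use assms(3) kronecker_sum_coercive[OF assms(4)] in auto)
  then have "?K ** matrix_inv ?K = mat 1" 
    unfolding invertible_def matrix_inv_def by (rule someI2_ex) simp
  then have "?K *v vec_stack \<Sigma> = \<gamma>\<^sup>2 *\<^sub>R vec_stack C"
    using assms(2) unfolding is_Sigma_inf_def B_def[symmetric]
    by (simp add: matrix_vector_mult_scaleR matrix_vector_mul_assoc)
  then show ?thesis
    by (simp add: kronecker_sum_mult_vec_stack vec_stack_eq_iff flip: vec_stack_scaleR)
qed

text \<open>
  A unit vector \<open>v\<close> maximizing \<open>norm (transpose A *v v)\<close>, with maximum \<open>a\<close>, is an eigenvector of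
  \<open>A ** transpose A\<close> for the eigenvalue \<open>a\<^sup>2\<close>; the Lyapunov equation is tested on it.
\<close>

lemma Lyapunov_factor_bound:
  fixes A B K :: "real ^ 'd::finite ^ 'd"
  assumes "B ** (A ** transpose A) + (A ** transpose A) ** transpose B = K"
    and "\<And>v. c * (norm v)\<^sup>2 \<le> v \<bullet> (B *v v)" and "c \<ge> 0"
  shows "2 * c * (norm (A *v w))\<^sup>2 \<le> spectral_norm K * (norm w)\<^sup>2"
proof -
  let ?T = "transpose A" and ?S = "A ** transpose A"
  have "continuous_on (sphere 0 1) (\<lambda>v. norm (?T *v v))"
    by (intro continuous_on_norm linear_continuous_on matrix_vector_mul_bounded_linear)
  then obtain v :: "real ^ 'd" where v: "norm v = 1"
    and v_max: "\<And>u. norm u = 1 \<Longrightarrow> norm (?T *v u) \<le> norm (?T *v v)"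
    using continuous_attains_sup[of "sphere 0 1 :: (real ^ 'd) set" "\<lambda>v. norm (?T *v v)"] by auto
  define a where "a = norm (?T *v v)"
  have T_le: "norm (?T *v u) \<le> a * norm u" for u
  proof (cases "u = 0")
    case False
    have "norm (?T *v u) = norm u * norm (?T *v (u /\<^sub>R norm u))"
      using False by (simp add: matrix_vector_mult_scaleR)
    also have "\<dots> \<le> norm u * a"
      unfolding a_def using False by (intro mult_left_mono v_max) auto
    finally show ?thesis by (simp add: mult.commute)
  qed simp
  have adj: "u \<bullet> (N *v z) = (transpose N *v u) \<bullet> z" for N :: "real ^ 'd ^ 'd" and u z
    by (metis dot_lmul_matrix transpose_matrix_vector)
  \<comment> \<open>The bound passes from \<open>?T\<close> to \<open>A\<close>: one
    \<open>A\<close> in the squared norm of \<open>A *v u\<close> moves across the inner product,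
    and a factor \<open>norm (A *v u)\<close> cancels.\<close>
  have A_le: "norm (A *v u) \<le> a * norm u" for u
  proof -
    have "(norm (A *v u))\<^sup>2 = (?T *v (A *v u)) \<bullet> u"
      by (simp add: power2_norm_eq_inner adj)
    also have "\<dots> \<le> norm (?T *v (A *v u)) * norm u" by (rule norm_cauchy_schwarz)
    also have "\<dots> \<le> (a * norm (A *v u)) * norm u" by (intro mult_right_mono T_le) simp
    finally have "norm (A *v u) * norm (A *v u) \<le> norm (A *v u) * (a * norm u)"
      by (simp add: power2_eq_square algebra_simps)
    then show ?thesis
      by (cases "A *v u = 0") (auto simp: a_def)
  qed
  have S_v: "?S *v v = A *v (?T *v v)" by (rule matrix_vector_mul_assoc[symmetric])
  have "norm (?S *v v) \<le> a * a"
    using A_le[of "?T *v v"] by (simp add: S_v a_def)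
  then have "(norm (?S *v v))\<^sup>2 \<le> (a\<^sup>2)\<^sup>2"
    by (intro power_mono) (auto simp: power2_eq_square)
  moreover have "v \<bullet> (?S *v v) = a\<^sup>2"
    by (simp add: S_v adj a_def power2_norm_eq_inner)
  \<comment> \<open>Equality case of Cauchy-Schwarz: by the two preceding facts this expansion is at
    most \<open>a^4 - 2 * a^4 + a^4 = 0\<close>.\<close>
  moreover have "(norm (?S *v v - a\<^sup>2 *\<^sub>R v))\<^sup>2
      = (norm (?S *v v))\<^sup>2 - 2 * a\<^sup>2 * (v \<bullet> (?S *v v)) + (a\<^sup>2)\<^sup>2 * (norm v)\<^sup>2"
    unfolding power2_norm_eq_inner
    by (simp add: inner_diff inner_commute algebra_simps power2_eq_square[of "a\<^sup>2"])
  ultimately have "(norm (?S *v v - a\<^sup>2 *\<^sub>R v))\<^sup>2 \<le> 0"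
    using v by (simp add: power2_eq_square)
  then have eig: "?S *v v = a\<^sup>2 *\<^sub>R v" by simp
  \<comment> \<open>Since \<open>?S\<close> is symmetric, it can be moved onto the left copy of
    \<open>v\<close>, so both terms of the Lyapunov equation contribute the same multiple of
    \<open>v \<bullet> (B *v v)\<close>.\<close>
  have "v \<bullet> ((?S ** transpose B) *v v) = v \<bullet> (transpose ?S *v (transpose B *v v))"
    by (simp only: matrix_transpose_mul transpose_transpose matrix_vector_mul_assoc)
  also have "\<dots> = (?S *v v) \<bullet> (transpose B *v v)"
    by (simp only: adj[of v "transpose ?S"] transpose_transpose)
  also have "\<dots> = a\<^sup>2 * (v \<bullet> (transpose B *v v))"
    by (simp only: eig inner_scaleR_left)
  also have "v \<bullet> (transpose B *v v) = v \<bullet> (B *v v)"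
    by (simp only: adj[of v "transpose B"] transpose_transpose inner_commute)
  finally have "v \<bullet> ((?S ** transpose B) *v v) = a\<^sup>2 * (v \<bullet> (B *v v))" .
  moreover have "v \<bullet> ((B ** ?S) *v v) = a\<^sup>2 * (v \<bullet> (B *v v))"
    by (simp only: matrix_vector_mul_assoc[of B ?S v, symmetric] eig matrix_vector_mult_scaleR
        inner_scaleR_right)
  ultimately have "v \<bullet> (K *v v) = 2 * (a\<^sup>2 * (v \<bullet> (B *v v)))"
    by (simp only: assms(1)[symmetric] matrix_vector_mult_add_rdistrib inner_add_right mult_2)
  moreover have "c * a\<^sup>2 \<le> a\<^sup>2 * (v \<bullet> (B *v v))"
    using mult_left_mono[OF assms(2)[of v], of "a\<^sup>2"] v by (simp add: mult.commute)
  moreover have "v \<bullet> (K *v v) \<le> spectral_norm K"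
    using quadratic_form_le_spectral_norm[of v K] v by simp
  ultimately have K: "2 * c * a\<^sup>2 \<le> spectral_norm K" unfolding mult.assoc by linarith
  have "(norm (A *v w))\<^sup>2 \<le> (a * norm w)\<^sup>2" by (intro power_mono A_le) simp
  then have "2 * c * (norm (A *v w))\<^sup>2 \<le> 2 * c * (a\<^sup>2 * (norm w)\<^sup>2)"
    using assms(3) by (intro mult_left_mono) (auto simp: power_mult_distrib)
  also have "\<dots> \<le> spectral_norm K * (norm w)\<^sup>2"
    using mult_right_mono[OF K, of "(norm w)\<^sup>2"] by (simp add: mult.assoc)
  finally show ?thesis .
qed

lemma spectral_norm_scaleR: "spectral_norm (c *\<^sub>R A) = \<bar>c\<bar> * spectral_norm A"
  using onorm_scaleR[OF matrix_vector_mul_bounded_linear[of A], of c]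
  by (simp add: spectral_norm_def scaleR_matrix_vector_assoc)

section \<open>Strong convexity as a lower bound on the Hessian\<close>

text \<open>Adding the strong convexity inequalities for \<open>(x, y)\<close> and
  \<open>(y, x)\<close> cancels the values of \<open>f\<close>.\<close>

lemma strongly_convex_on_gradient_monotone:
  assumes "strongly_convex_on X f g \<mu>" "x \<in> X" "y \<in> X"
  shows "\<mu> * (norm (y - x))\<^sup>2 \<le> (g y - g x) \<bullet> (y - x)"
proof -
  have "\<mu> / 2 * (norm (x - y))\<^sup>2 \<le> f y - f x - g x \<bullet> (y - x)"
    and "\<mu> / 2 * (norm (y - x))\<^sup>2 \<le> f x - f y - g y \<bullet> (x - y)"
    using assms unfolding strongly_convex_on_def by blast+
  then show ?thesis
    by (simp add: norm_minus_commute inner_diff algebra_simps)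
qed

text \<open>The form \<open>v \<bullet> (H x *v v)\<close> is the limit of difference quotients of
  the gradient along \<open>v\<close>. For small \<open>t > 0\<close> the point
  \<open>x + t *\<^sub>R v\<close> stays in \<open>X\<close>, where gradient monotonicity bounds the
  quotient from below.\<close>

lemma Hessian_coercive_interior:
  assumes "C2_on X f g H" "strongly_convex_on X f g \<mu>" and x: "x \<in> interior X"
  shows "\<mu> * (norm v)\<^sup>2 \<le> v \<bullet> (H x *v v)"
proof -
  have "x \<in> X" using x interior_subset by blast
  then have "(g has_derivative (\<lambda>h. H x *v h)) (at x within X)"
    using assms(1) unfolding C2_on_def by blast
  then have "(g has_derivative (\<lambda>h. H x *v h)) (at x)"
    using at_within_interior[OF x] by simp
  moreover have "((\<lambda>t. x + t *\<^sub>R v) has_derivative (\<lambda>t. t *\<^sub>R v)) (at 0)"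
    by (auto intro!: derivative_eq_intros)
  ultimately have "((\<lambda>t. g (x + t *\<^sub>R v)) has_derivative (\<lambda>t. H x *v (t *\<^sub>R v))) (at 0)"
    using has_derivative_compose[of "\<lambda>t. x + t *\<^sub>R v" "\<lambda>t. t *\<^sub>R v" 0 UNIV g "\<lambda>h. H x *v h"] by simp
  then have "((\<lambda>t. g (x + t *\<^sub>R v) \<bullet> v) has_derivative (\<lambda>t. (H x *v (t *\<^sub>R v)) \<bullet> v)) (at 0)"
    by (rule has_derivative_inner_left)
  then have "((\<lambda>t. g (x + t *\<^sub>R v) \<bullet> v) has_field_derivative ((H x *v v) \<bullet> v)) (at 0)"
    by (simp add: has_field_derivative_def matrix_vector_mult_scaleR mult.commute[of _ "_ \<bullet> _"])
  then have "((\<lambda>t. (g (x + t *\<^sub>R v) \<bullet> v - g x \<bullet> v) / t) \<longlongrightarrow> (H x *v v) \<bullet> v) (at 0)"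
    by (simp add: DERIV_def)
  then have lim: "((\<lambda>t. (g (x + t *\<^sub>R v) \<bullet> v - g x \<bullet> v) / t) \<longlongrightarrow> (H x *v v) \<bullet> v) (at_right 0)"
    by (rule filterlim_mono) (auto simp: at_le)
  have "((\<lambda>t. x + t *\<^sub>R v) \<longlongrightarrow> x + 0 *\<^sub>R v) (at_right 0)"
    by (intro tendsto_intros)
  then have "eventually (\<lambda>t. x + t *\<^sub>R v \<in> interior X) (at_right 0)"
    using x by (intro topological_tendstoD) auto
  then have "eventually (\<lambda>t. \<mu> * (norm v)\<^sup>2 \<le> (g (x + t *\<^sub>R v) \<bullet> v - g x \<bullet> v) / t) (at_right 0)"
    using eventually_at_right_less[of 0]
  proof eventually_elim
    case (elim t)
    then have "x + t *\<^sub>R v \<in> X" using interior_subset by blast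
    from strongly_convex_on_gradient_monotone[OF assms(2) \<open>x \<in> X\<close> this]
    \<comment> \<open>The displacement \<open>t *\<^sub>R v\<close> enters quadratically on the left
      and linearly on the right; one \<open>t\<close> cancels and the other becomes the
      denominator.\<close>
    have "t * (t * (\<mu> * (norm v)\<^sup>2)) \<le> t * (g (x + t *\<^sub>R v) \<bullet> v - g x \<bullet> v)"
      by (simp add: power_mult_distrib inner_diff_left power2_eq_square algebra_simps)
    then show ?case using \<open>0 < t\<close> by (simp add: pos_le_divide_eq mult.commute)
  qed
  from tendsto_lowerbound[OF lim this] show ?thesis by (simp add: inner_commute)
qed

text \<open>The point may lie on the boundary. If the interior is nonempty, \<open>X\<close> is its
  closure and continuity of \<open>H\<close> carries the interior bound over; otherwise the bound
  comes from \<open>degenerate\<close>.\<close>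

lemma Hessian_coercive:
  assumes "closed X" "convex X" "C2_on X f g H" "strongly_convex_on X f g \<mu>"
    and degenerate: "interior X = {} \<Longrightarrow> loewner_le (\<mu> *\<^sub>R mat 1) (H x)" and "x \<in> X"
  shows "\<mu> * (norm v)\<^sup>2 \<le> v \<bullet> (H x *v v)"
proof (cases "interior X = {}")
  case True
  then have "0 \<le> v \<bullet> ((H x - \<mu> *\<^sub>R mat 1) *v v)"
    using degenerate unfolding loewner_le_def by blast
  then show ?thesis
    by (simp add: matrix_vector_mult_diff_rdistrib inner_diff_right power2_norm_eq_inner
        flip: scaleR_matrix_vector_assoc)
next
  case False
  have X: "closure (interior X) = X"
    using convex_closure_interior[OF \<open>convex X\<close> False] \<open>closed X\<close> by simp
  have "continuous_on X H" using assms(3) unfolding C2_on_def by blast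
  then have "continuous_on X (\<lambda>x. v \<bullet> (H x *v v))"
    unfolding matrix_vector_mult_def by (intro continuous_intros)
  then show ?thesis
    using continuous_ge_on_closure[of "interior X" "\<lambda>x. v \<bullet> (H x *v v)" x "\<mu> * (norm v)\<^sup>2"]
      Hessian_coercive_interior[OF assms(3,4)] \<open>x \<in> X\<close> by (simp add: X)
qed

section \<open>The sample size and the optimal step size\<close>

lemma sample_size_correct:
  "sample_size d \<epsilon> \<alpha> b \<ge> 1 \<and>
     real (sample_size d \<epsilon> \<alpha> b) \<ge> b / \<epsilon> * max (4 * ln (1 / \<alpha>) + 3 * real d / 2) (2 * real d)"
proof -
  let ?t = "b / \<epsilon> * max (4 * ln (1 / \<alpha>) + 3 * real d / 2) (2 * real d)"
  obtain n :: nat where "?t \<le> real n" using real_arch_simple by blast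
  then have "Suc n \<ge> 1 \<and> ?t \<le> real (Suc n)" by simp
  then show ?thesis unfolding sample_size_def by (rule LeastI)
qed

text \<open>The \<open>max\<close> is at least \<open>2 * real d\<close>, hence nonnegative, so the
  threshold is monotone in \<open>b\<close> and the sample size for \<open>b'\<close> is admissible
  for \<open>b\<close>.\<close>

lemma sample_size_mono:
  assumes "\<epsilon> > 0" "b \<le> b'"
  shows "sample_size d \<epsilon> \<alpha> b \<le> sample_size d \<epsilon> \<alpha> b'"
proof -
  let ?m = "max (4 * ln (1 / \<alpha>) + 3 * real d / 2) (2 * real d)"
  have "b / \<epsilon> * ?m \<le> b' / \<epsilon> * ?m"
    using assms by (intro mult_right_mono divide_right_mono) (auto simp: le_max_iff_disj)
  with sample_size_correct[where b = b' and d = d and \<epsilon> = \<epsilon> and \<alpha> = \<alpha>]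
  show ?thesis unfolding sample_size_def[of d \<epsilon> \<alpha> b] by (intro Least_le) linarith
qed

lemma b_const_minimal:
  assumes "\<mu> > 0" "\<gamma> > 1 / (2 * \<mu>)"
  shows "b_const \<mu> C Hs (1 / \<mu>) \<le> b_const \<mu> C Hs \<gamma>"
proof -
  have pos: "2 * \<gamma> * \<mu> - 1 > 0" using assms by (simp add: field_simps)
  \<comment> \<open>Expanded, this reads
    \<open>2 * \<gamma> * \<mu> - 1 \<le> (\<gamma> * \<mu>)\<^sup>2\<close>; both sides are then
    divided by \<open>\<mu>\<^sup>2\<close> and the positive left side.\<close>
  have "0 \<le> (\<gamma> * \<mu> - 1)\<^sup>2" by simp
  then have "1 / \<mu>\<^sup>2 \<le> \<gamma>\<^sup>2 / (2 * \<gamma> * \<mu> - 1)"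
    using assms pos by (simp add: field_simps power2_eq_square)
  moreover have "(1 / \<mu>)\<^sup>2 / (2 * (1 / \<mu>) * \<mu> - 1) = 1 / \<mu>\<^sup>2"
    using assms by (simp add: power_divide)
  ultimately show ?thesis
    unfolding b_const_def by (intro mult_right_mono spectral_norm_nonneg) simp
qed

section \<open>Tail of the limit law and transfer to the iterates\<close>

text \<open>
  When the pushforward is not a measure, \<open>distr\<close> yields the null measure; a nonzero total mass
  therefore replaces measurability of \<open>h\<close>.
\<close>

lemma emeasure_distr_nontrivial:
  assumes "emeasure (distr M N h) (space N) \<noteq> 0" "A \<in> sets N"
  shows "emeasure (distr M N h) A = emeasure M (h -` A \<inter> space M)"
proof -
  have *: "emeasure (distr M N h) A =
      (if A \<in> sigma_sets (space N) (sets N) \<and>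
          measure_space (space N) (sigma_sets (space N) (sets N)) (\<lambda>A. emeasure M (h -` A \<inter> space M))
       then emeasure M (h -` A \<inter> space M) else 0)" for A
    unfolding distr_def emeasure_measure_of_conv ..
  show ?thesis using *[of "space N"] *[of A] assms by (auto simp: sets.sigma_sets_eq split: if_splits)
qed

text \<open>The comparison is pointwise in the standard normal vector: a quadratic form above
  \<open>s\<close> forces the squared norm above the threshold of
  \<open>std_normal_norm_tail\<close>. It is applied with \<open>s\<close> equal to the sample size
  times \<epsilon>.\<close>

lemma normal_quadratic_form_tail:
  fixes \<Sigma> Hs C :: "real ^ 'd::finite ^ 'd"
  assumes Z: "normal_vector P Z 0 \<Sigma>" and \<Sigma>: "is_Sigma_inf \<gamma> Hs C \<Sigma>"
    and Hs: "\<And>v. \<mu> * (norm v)\<^sup>2 \<le> v \<bullet> (Hs *v v)"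
    and "\<mu> > 0" "\<gamma> > 1 / (2 * \<mu>)" "0 < \<alpha>" "0 < s"
    and s: "b_const \<mu> C Hs \<gamma> * (4 * ln (1 / \<alpha>) + 3 * real CARD('d) / 2) \<le> s"
  shows "emeasure (distr P borel (\<lambda>z. Z z \<bullet> (Hs *v Z z))) {s<..} \<le> ennreal \<alpha>"
proof -
  let ?S = "std_normal_vec :: (real ^ 'd) measure"
  define B where "B = \<gamma> *\<^sub>R Hs - (1 / 2) *\<^sub>R mat 1"
  \<comment> \<open>The coercivity constant of \<open>B\<close>; twice it is the denominator in
    \<open>b_const\<close>.\<close>
  define c where "c = \<gamma> * \<mu> - 1 / 2"
  define t where "t = 4 * ln (1 / \<alpha>) + 3 * real CARD('d) / 2"
  have c: "c > 0" using \<open>\<mu> > 0\<close> \<open>\<gamma> > 1 / (2 * \<mu>)\<close> by (simp add: c_def field_simps)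
  have "0 < 1 / (2 * \<mu>)" using \<open>\<mu> > 0\<close> by simp
  with \<open>\<gamma> > 1 / (2 * \<mu>)\<close> have "\<gamma> > 0" by linarith
  have B: "c * (norm v)\<^sup>2 \<le> v \<bullet> (B *v v)" for v
  proof -
    have "v \<bullet> (B *v v) = \<gamma> * (v \<bullet> (Hs *v v)) - (norm v)\<^sup>2 / 2"
      by (simp add: B_def matrix_vector_mult_diff_rdistrib inner_diff_right power2_norm_eq_inner
          flip: scaleR_matrix_vector_assoc)
    with mult_left_mono[OF Hs[of v], of \<gamma>] \<open>\<gamma> > 0\<close> show ?thesis
      by (simp add: c_def algebra_simps)
  qed
  obtain A where A: "\<Sigma> = A ** transpose A"
    and law: "distr P borel Z = distr ?S borel (\<lambda>w. 0 + A *v w)"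
    and [measurable]: "Z \<in> borel_measurable P"
    using Z unfolding normal_vector_def by blast
  have Lyap: "B ** (A ** transpose A) + (A ** transpose A) ** transpose B = \<gamma>\<^sup>2 *\<^sub>R C"
    using Lyapunov_equation[OF \<Sigma> c] B unfolding B_def A by blast
  have q_le: "(A *v w) \<bullet> (Hs *v (A *v w)) \<le> b_const \<mu> C Hs \<gamma> * (norm w)\<^sup>2" for w
  proof -
    have "2 * c * (norm (A *v w))\<^sup>2 \<le> \<gamma>\<^sup>2 * spectral_norm C * (norm w)\<^sup>2"
      using Lyapunov_factor_bound[OF Lyap B, of w] c by (simp add: spectral_norm_scaleR)
    then have "(norm (A *v w))\<^sup>2 \<le> \<gamma>\<^sup>2 / (2 * \<gamma> * \<mu> - 1) * spectral_norm C * (norm w)\<^sup>2"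
      using c by (simp add: c_def field_simps)
    from mult_left_mono[OF this spectral_norm_nonneg[of Hs]]
    show ?thesis
      using quadratic_form_le_spectral_norm[of "A *v w" Hs]
      by (simp add: b_const_def mult.assoc mult.left_commute)
  qed
  have incl: "(norm w)\<^sup>2 > t" if "(A *v w) \<bullet> (Hs *v (A *v w)) > s" for w
  proof (rule ccontr)
    assume "\<not> (norm w)\<^sup>2 > t"
    moreover have "b_const \<mu> C Hs \<gamma> \<ge> 0"
      unfolding b_const_def using c by (intro mult_nonneg_nonneg spectral_norm_nonneg divide_nonneg_nonneg) (auto simp: c_def)
    ultimately have "b_const \<mu> C Hs \<gamma> * (norm w)\<^sup>2 \<le> b_const \<mu> C Hs \<gamma> * t"
      by (intro mult_left_mono) auto
    with q_le[of w] s that show False by (simp add: t_def)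
  qed
  have [simp, measurable_cong]: "sets ?S = sets borel" and [simp]: "space ?S = UNIV"
    by (simp_all add: std_normal_vec_def)
  have lin: "(\<lambda>v. N *v v) \<in> borel_measurable borel" for N :: "real ^ 'd ^ 'd"
    by (intro borel_measurable_continuous_onI linear_continuous_on matrix_vector_mul_bounded_linear)
  have q: "(\<lambda>v. v \<bullet> (Hs *v v)) \<in> borel_measurable borel"
    using lin by measurable
  \<comment> \<open>\<open>normal_vector\<close> describes only the law of \<open>Z\<close>, so the
    form is first written as a pushforward of that law, and only then is \<open>A *v w\<close>
    substituted.\<close>
  have "distr P borel (\<lambda>z. Z z \<bullet> (Hs *v Z z)) = distr (distr P borel Z) borel (\<lambda>v. v \<bullet> (Hs *v v))"
    using q by (simp add: distr_distr comp_def)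
  also have "\<dots> = distr ?S borel (\<lambda>w. (A *v w) \<bullet> (Hs *v (A *v w)))"
    unfolding law using q lin[of A] by (simp add: distr_distr comp_def)
  finally have "emeasure (distr P borel (\<lambda>z. Z z \<bullet> (Hs *v Z z))) {s<..}
      = emeasure ?S {w. (A *v w) \<bullet> (Hs *v (A *v w)) > s}"
    using measurable_compose[OF lin[of A] q] by (simp add: emeasure_distr vimage_def)
  also have "\<dots> \<le> emeasure ?S {w. (norm w)\<^sup>2 > t}"
    using incl by (intro emeasure_mono) auto
  also have "\<dots> \<le> ennreal \<alpha>"
    unfolding t_def by (rule std_normal_norm_tail) fact
  finally show ?thesis .
qed

theorem theorem3:
  fixes X :: "(real ^ 'd::finite) set"
    and f :: "real ^ 'd \<Rightarrow> real"
    and g :: "real ^ 'd \<Rightarrow> real ^ 'd"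
    and H :: "real ^ 'd \<Rightarrow> real ^ 'd ^ 'd"
    and xstar :: "real ^ 'd"
    and \<mu> \<gamma> \<epsilon> \<alpha> :: real
    and D :: "'s measure"
    and G :: "real ^ 'd \<Rightarrow> 's \<Rightarrow> real ^ 'd"
    and M :: "'w measure"
    and \<xi> :: "nat \<Rightarrow> 'w \<Rightarrow> 's"
    and x :: "nat \<Rightarrow> 'w \<Rightarrow> real ^ 'd"
    and P :: "'z measure"
    and Z :: "'z \<Rightarrow> real ^ 'd"
    and \<Sigma> :: "real ^ 'd ^ 'd"
  defines "C \<equiv> cov_mat D (G xstar)"
    and "b \<equiv> b_const \<mu> (cov_mat D (G xstar)) (H xstar)"
  assumes "closed X" and "convex X"
    and "C2_on X f g H"
    and "\<mu> > 0" and "strongly_convex_on X f g \<mu>"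
    \<comment> \<open>If X has nonempty interior, strong convexity implies this bound; otherwise the derivatives
        relative to X leave the Hessian undetermined in directions transversal to X.\<close>
    and "interior X = {} \<Longrightarrow> loewner_le (\<mu> *\<^sub>R mat 1) (H xstar)"
    and "xstar \<in> X" and "\<And>y. y \<in> X \<Longrightarrow> f xstar \<le> f y"
    and "\<gamma> > 1 / (2 * \<mu>)"
    and "stochastic_gradient D X g G"
    and "sgd_iterates M D X G \<gamma> \<xi> x"
    and "\<epsilon> > 0" and "0 < \<alpha>" and "\<alpha> < 1"
    and "is_Sigma_inf \<gamma> (H xstar) C \<Sigma>"
    and "normal_vector P Z 0 \<Sigma>"
    and "\<And>N. N \<ge> 1 \<Longrightarrow>
           distr M borel (\<lambda>\<omega>. real N * (f (x N \<omega>) - f xstar)) =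
           distr P borel (\<lambda>z. Z z \<bullet> (H xstar *v Z z))"
  shows "measure M {\<omega> \<in> space M. f (x (sample_size CARD('d) \<epsilon> \<alpha> (b \<gamma>)) \<omega>) - f xstar > \<epsilon>} \<le> \<alpha> \<and>
         is_arg_min (\<lambda>\<gamma>'. sample_size CARD('d) \<epsilon> \<alpha> (b \<gamma>')) (\<lambda>\<gamma>'. \<gamma>' > 1 / (2 * \<mu>)) (1 / \<mu>) \<and>
         b (1 / \<mu>) = 1 / \<mu>\<^sup>2 * spectral_norm C * spectral_norm (H xstar)"
proof (intro conjI)
  let ?N = "sample_size CARD('d) \<epsilon> \<alpha> (b \<gamma>)"
  let ?Y = "\<lambda>\<omega>. real ?N * (f (x ?N \<omega>) - f xstar)"
  let ?Q = "distr P borel (\<lambda>z. Z z \<bullet> (H xstar *v Z z))"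
  have N: "?N \<ge> 1"
    and N_ge: "b \<gamma> / \<epsilon> * max (4 * ln (1 / \<alpha>) + 3 * real CARD('d) / 2) (2 * real CARD('d)) \<le> real ?N"
    using sample_size_correct by blast+
  have "1 / (2 * \<mu>) > 0" using \<open>\<mu> > 0\<close> by simp
  have Hess: "\<mu> * (norm v)\<^sup>2 \<le> v \<bullet> (H xstar *v v)" for v
    by (rule Hessian_coercive) fact+
  have b_nonneg: "b \<gamma> \<ge> 0"
    using \<open>\<mu> > 0\<close> \<open>\<gamma> > 1 / (2 * \<mu>)\<close> unfolding b_def b_const_def
    by (intro mult_nonneg_nonneg spectral_norm_nonneg divide_nonneg_nonneg) (auto simp: field_simps)
  have "b \<gamma> * (4 * ln (1 / \<alpha>) + 3 * real CARD('d) / 2)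
      \<le> b \<gamma> * max (4 * ln (1 / \<alpha>) + 3 * real CARD('d) / 2) (2 * real CARD('d))"
    using b_nonneg by (intro mult_left_mono) auto
  also have "\<dots> \<le> real ?N * \<epsilon>"
    using N_ge \<open>\<epsilon> > 0\<close> by (simp add: pos_divide_le_eq)
  finally have "b \<gamma> * (4 * ln (1 / \<alpha>) + 3 * real CARD('d) / 2) \<le> real ?N * \<epsilon>" .
  moreover have "real ?N * \<epsilon> > 0" using N \<open>\<epsilon> > 0\<close> by simp
  ultimately have tail: "emeasure ?Q {real ?N * \<epsilon><..} \<le> ennreal \<alpha>"
    using normal_quadratic_form_tail[OF \<open>normal_vector P Z 0 \<Sigma>\<close> \<open>is_Sigma_inf \<gamma> (H xstar) C \<Sigma>\<close>
        Hess \<open>\<mu> > 0\<close> \<open>\<gamma> > 1 / (2 * \<mu>)\<close> \<open>0 < \<alpha>\<close>]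
    unfolding C_def b_def by blast
  have law: "distr M borel ?Y = ?Q" using N by (rule assms)
  have "prob_space ?Q"
  proof (rule prob_space.prob_space_distr)
    show "prob_space P" using \<open>normal_vector P Z 0 \<Sigma>\<close> by (simp add: normal_vector_def)
    have "(\<lambda>v. H xstar *v v) \<in> borel_measurable borel"
      by (intro borel_measurable_continuous_onI linear_continuous_on matrix_vector_mul_bounded_linear)
    moreover have "Z \<in> borel_measurable P"
      using \<open>normal_vector P Z 0 \<Sigma>\<close> by (simp add: normal_vector_def)
    ultimately show "(\<lambda>z. Z z \<bullet> (H xstar *v Z z)) \<in> borel_measurable P"
      by measurable
  qed
  \<comment> \<open>\<open>?Q\<close> has mass 1, so by \<open>law\<close> the pushforward of
    \<open>?Y\<close> is not the null measure and takes the values of \<open>M\<close> on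
    preimages.\<close>
  then have "emeasure (distr M borel ?Y) (space borel) \<noteq> 0"
    using prob_space.emeasure_space_1 unfolding law by fastforce
  then have "emeasure ?Q {real ?N * \<epsilon><..} = emeasure M (?Y -` {real ?N * \<epsilon><..} \<inter> space M)"
    unfolding law[symmetric] by (rule emeasure_distr_nontrivial) simp
  also have "?Y -` {real ?N * \<epsilon><..} \<inter> space M = {\<omega> \<in> space M. f (x ?N \<omega>) - f xstar > \<epsilon>}"
    using N by auto
  finally have "emeasure M {\<omega> \<in> space M. f (x ?N \<omega>) - f xstar > \<epsilon>} \<le> ennreal \<alpha>"
    using tail by simp
  then show "measure M {\<omega> \<in> space M. f (x ?N \<omega>) - f xstar > \<epsilon>} \<le> \<alpha>"
    unfolding measure_def using \<open>0 < \<alpha>\<close> by (intro enn2real_leI) auto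
next
  show "is_arg_min (\<lambda>\<gamma>'. sample_size CARD('d) \<epsilon> \<alpha> (b \<gamma>')) (\<lambda>\<gamma>'. \<gamma>' > 1 / (2 * \<mu>)) (1 / \<mu>)"
    \<comment> \<open>\<open>frac_less2\<close> places \<open>1 / \<mu>\<close> inside the open
      range; minimality passes from \<open>b\<close> to the sample size by monotonicity.\<close>
    unfolding is_arg_min_def not_less b_def using \<open>\<mu> > 0\<close>
    by (auto simp: not_less frac_less2 intro!: sample_size_mono \<open>\<epsilon> > 0\<close> b_const_minimal)
next
  show "b (1 / \<mu>) = 1 / \<mu>\<^sup>2 * spectral_norm C * spectral_norm (H xstar)"
    using \<open>\<mu> > 0\<close> by (simp add: b_def b_const_def C_def power_divide)
qed

end
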